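(* Let $T$ be a (finite) tree. If $T$ is not isomorphic to any of the following seven trees: $P_2, P_3, P_4, P_5, P_6$ (where $P_m$ denotes the path with $m$ vertices), the tree $T7$ with vertex set $\{1,2,3,4,5\}$ and edge set $\{\{1,2\},\{2,3\},\{2,4\},\{4,5\}\}$, the tree $T12$ with vertex set $\{1,\dots,6\}$ and edge set $\{\{1,2\},\{2,3\},\{3,4\},\{2,5\},\{5,6\}\}$, then $T$ is an edge intersection hypergraph of a 3-uniform hypergraph, i.e. there exists a 3-uniform hypergraph $\mathcal H=(V(T),\mathcal E)$ with $EI(\mathcal H)=T$.
   Context: A hypergraph $\mathcal H=(V,\mathcal E)$ consists of a finite vertex set $V$ and a set $\mathcal E$ of subsets of $V$ (hyperedges); there are no multiple hyperedges and no loops. $\mathcal H$ is $k$-uniform if every hyperedge has exactly $k$ elements; a (simple, undirected) graph is identified with a 2-uniform hypergraph on the same vertex set. The edge intersection hypergraph of $\mathcal H=(V,\mathcal E)$ is $EI(\mathcal H)=(V,\mathcal E^{EI})$ with $\mathcal E^{EI}=\{e_1\cap e_2 \mid e_1,e_2\in\mathcal E,\ e_1\neq e_2,\ |e_1\cap e_2|\ge 2\}$. For a graph $G$, "$EI(\mathcal H)=G$" means $\mathcal H$ has vertex set $V(G)$ and $\mathcal E^{EI}=E(G)$. *)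

theory Defs
  imports Main
begin

type_synonym 'a hypergraph = "'a set \<times> 'a set set"

abbreviation verts :: "'a hypergraph \<Rightarrow> 'a set" where
  "verts \<equiv> fst"

abbreviation edges :: "'a hypergraph \<Rightarrow> 'a set set" where
  "edges \<equiv> snd"

definition hypergraph :: "'a hypergraph \<Rightarrow> bool" where
  "hypergraph H \<longleftrightarrow> finite (verts H) \<and> (\<forall>e\<in>edges H. e \<subseteq> verts H \<and> card e \<noteq> 1)"

definition uniform_hypergraph :: "nat \<Rightarrow> 'a hypergraph \<Rightarrow> bool" where
  "uniform_hypergraph k H \<longleftrightarrow> hypergraph H \<and> (\<forall>e\<in>edges H. card e = k)"

definition EI :: "'a hypergraph \<Rightarrow> 'a hypergraph" where
  "EI H = (verts H,
     {e1 \<inter> e2 |e1 e2. e1 \<in> edges H \<and> e2 \<in> edges H \<and> e1 \<noteq> e2 \<and> 2 \<le> card (e1 \<inter> e2)})"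

definition simple_graph :: "'a hypergraph \<Rightarrow> bool" where
  "simple_graph G \<longleftrightarrow> uniform_hypergraph 2 G"

definition walk :: "'a hypergraph \<Rightarrow> 'a list \<Rightarrow> bool" where
  "walk G xs \<longleftrightarrow>
     xs \<noteq> [] \<and> set xs \<subseteq> verts G \<and> successively (\<lambda>x y. {x, y} \<in> edges G) xs"

definition connected_graph :: "'a hypergraph \<Rightarrow> bool" where
  "connected_graph G \<longleftrightarrow> verts G \<noteq> {} \<and>
     (\<forall>u\<in>verts G. \<forall>v\<in>verts G. \<exists>xs. walk G xs \<and> hd xs = u \<and> last xs = v)"

(* The list contains each vertex of the cycle once; the last condition is the closing edge. *)
definition cycle_in :: "'a hypergraph \<Rightarrow> 'a list \<Rightarrow> bool" where
  "cycle_in G xs \<longleftrightarrow>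
     walk G xs \<and> distinct xs \<and> 3 \<le> length xs \<and> {last xs, hd xs} \<in> edges G"

(* The one-vertex graph is a tree, the graph without vertices is not. *)
definition tree :: "'a hypergraph \<Rightarrow> bool" where
  "tree T \<longleftrightarrow> simple_graph T \<and> connected_graph T \<and> (\<nexists>xs. cycle_in T xs)"

definition isomorphic :: "'a hypergraph \<Rightarrow> 'b hypergraph \<Rightarrow> bool" where
  "isomorphic G H \<longleftrightarrow>
     (\<exists>f. bij_betw f (verts G) (verts H) \<and> edges H = (\<lambda>e. f ` e) ` edges G)"

definition path_graph :: "nat \<Rightarrow> nat hypergraph" where
  "path_graph m = ({1..m}, {{i, i + 1} |i. 1 \<le> i \<and> i < m})"

definition T7 :: "nat hypergraph" where
  "T7 = ({1..5}, {{1, 2}, {2, 3}, {2, 4}, {4, 5}})"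

definition T12 :: "nat hypergraph" where
  "T12 = ({1..6}, {{1, 2}, {2, 3}, {3, 4}, {2, 5}, {5, 6}})"

end

theory Submission
  imports Defs
begin

text \<open>
  A set of triples has the tree \<open>T\<close> as its edge intersection hypergraph iff every edge of \<open>T\<close> lies
  in at least two triples and every other pair of vertices in at most one. Take all cherries
  \<open>{a, v, b}\<close> with \<open>a\<close> and \<open>b\<close> adjacent to \<open>v\<close>. As \<open>T\<close> has no 4-cycle, no pair \<open>{a, b}\<close> is used
  twice, and only the edges \<open>{l, v}\<close> between a leaf \<open>l\<close> and a vertex \<open>v\<close> of degree 2 are covered
  just once. For each such pendant pair add a triple \<open>{l, v, w l}\<close>, where \<open>w l\<close> is at distance at
  least 3 from \<open>v\<close>. The only remaining danger is a pair \<open>l, l'\<close> with \<open>w l\<close> in the pendant pair of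
  \<open>l'\<close> and vice versa.

  If there are at least three pendant pairs, let \<open>w\<close> permute the leaves cyclically. If there are one
  or two, a suitable \<open>w\<close> exists unless \<open>T\<close> has very small diameter. Then \<open>T\<close> is one of the
  exceptions, or the neighbour \<open>x\<close> of \<open>v\<close> has degree at least 4. In the latter case the cherry
  \<open>{v, x, a}\<close> for another neighbour \<open>a\<close> of \<open>x\<close> can be dropped, which makes \<open>w l = a\<close> possible.
\<close>

section \<open>Isomorphisms given by vertex lists\<close>

text \<open>The list is a labelling from \<open>{1..length xs}\<close> onto the vertices of
  \<open>G\<close>, with labels shifted by one against list positions. The isomorphism is its
  inverse, which undoes the labelling on each edge because edges of \<open>H\<close> stay within the
  labels.\<close>

lemma isomorphic_listI:
  assumes "distinct xs" "verts G = set xs" "verts H = {1..length xs}"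
    and "edges H \<subseteq> Pow (verts H)"
    and "edges G = (\<lambda>e. (\<lambda>i. xs ! (i - 1)) ` e) ` edges H"
  shows "isomorphic G H"
proof -
  define g where "g = (\<lambda>i. xs ! (i - 1))"
  have inj: "inj_on g (verts H)"
    using assms(1,3) unfolding g_def inj_on_def
    by (auto simp: nth_eq_iff_index_eq)
  have img: "g ` verts H = verts G"
  proof
    show "g ` verts H \<subseteq> verts G" using assms(2,3) by (auto simp: g_def)
    show "verts G \<subseteq> g ` verts H"
    proof
      fix u assume "u \<in> verts G"
      then obtain i where "i < length xs" "u = xs ! i"
        using assms(2) by (auto simp: in_set_conv_nth)
      then have "Suc i \<in> verts H" "u = g (Suc i)" using assms(3) by (auto simp: g_def)
      then show "u \<in> g ` verts H" by blast
    qed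
  qed
  let ?f = "the_inv_into (verts H) g"
  have "bij_betw ?f (verts G) (verts H)"
    using inj img by (intro bij_betw_the_inv_into bij_betw_imageI)
  moreover have "?f ` g ` e = e" if "e \<in> edges H" for e
  proof -
    have "\<And>i. i \<in> e \<Longrightarrow> ?f (g i) = i"
      using that assms(4) inj by (auto intro: the_inv_into_f_f)
    then show ?thesis by (force simp: image_iff)
  qed
  then have "edges H = (\<lambda>e. ?f ` e) ` edges G"
    using assms(5) unfolding g_def[symmetric] by (simp add: image_image)
  ultimately show ?thesis unfolding isomorphic_def by blast
qed

text \<open>Recursive, so that simplification evaluates it on an explicit list of vertices;
  \<open>path_edges_nth\<close> gives the indexed form that matches
  \<open>path_graph\<close>.\<close>

fun path_edges :: "'a list \<Rightarrow> 'a set set" where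
  "path_edges (x # y # xs) = insert {x, y} (path_edges (y # xs))"
| "path_edges _ = {}"

lemma path_edges_nth: "path_edges xs = {{xs ! i, xs ! Suc i} |i. Suc i < length xs}"
proof (induction xs rule: path_edges.induct)
  case (1 x y xs)
  have "{{(x # y # xs) ! i, (x # y # xs) ! Suc i} |i. Suc i < length (x # y # xs)} =
    insert {x, y} {{(y # xs) ! i, (y # xs) ! Suc i} |i. Suc i < length (y # xs)}" (is "?L = ?R")
  proof
    show "?L \<subseteq> ?R"
    proof
      fix e assume "e \<in> ?L"
      then obtain i where i: "Suc i < length (x # y # xs)" "e = {(x # y # xs) ! i, (x # y # xs) ! Suc i}"
        by blast
      then show "e \<in> ?R" by (cases i) auto
    qed
    have "{x, y} \<in> ?L" by (intro CollectI exI[of _ 0]) simp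
    moreover have "{(y # xs) ! i, (y # xs) ! Suc i} \<in> ?L" if "Suc i < length (y # xs)" for i
      using that by (intro CollectI exI[of _ "Suc i"]) simp
    ultimately show "?R \<subseteq> ?L" by blast
  qed
  then show ?case using 1 by simp
qed auto

lemma isomorphic_path_graph:
  assumes "distinct xs" "verts G = set xs" "edges G = path_edges xs"
  shows "isomorphic G (path_graph (length xs))"
proof (rule isomorphic_listI[OF assms(1,2)])
  let ?g = "\<lambda>i. xs ! (i - 1)"
  have "{{xs ! i, xs ! Suc i} |i. Suc i < length xs} =
    (\<lambda>e. ?g ` e) ` {{i, i + 1} |i. 1 \<le> i \<and> i < length xs}" (is "?L = ?R")
  proof
    have "{xs ! i, xs ! Suc i} \<in> ?R" if "Suc i < length xs" for i
      using that by (intro image_eqI[of _ _ "{Suc i, Suc i + 1}"]) auto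
    then show "?L \<subseteq> ?R" by blast
    have "?g ` {i, i + 1} \<in> ?L" if "1 \<le> i" "i < length xs" for i
      using that by (intro CollectI exI[of _ "i - 1"]) simp
    then show "?R \<subseteq> ?L" by blast
  qed
  then show "edges G = (\<lambda>e. ?g ` e) ` edges (path_graph (length xs))"
    using assms(3) by (simp add: path_edges_nth path_graph_def)
qed (auto simp: path_graph_def)

section \<open>Cyclic shifts\<close>

text \<open>Transport the cyclic successor on \<open>{..<card A}\<close> to \<open>A\<close>. With
  at least three elements it has no fixed points and no 2-cycles; a 2-cycle would be exactly a clash
  of two extra triples.\<close>

lemma exists_shift_without_short_cycles:
  assumes "finite A" "3 \<le> card A"
  shows "\<exists>s. \<forall>a\<in>A. s a \<in> A \<and> s a \<noteq> a \<and> s (s a) \<noteq> a"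
proof -
  let ?n = "card A"
  obtain h where h: "bij_betw h {..<?n} A"
    using assms(1) ex_bij_betw_nat_finite atLeast0LessThan by metis
  define g where "g = the_inv_into {..<?n} h"
  define t where "t i = (if Suc i < ?n then Suc i else 0)" for i
  have hA: "h i \<in> A" and gh: "g (h i) = i" if "i < ?n" for i
    using h that unfolding g_def bij_betw_def by (auto simp: the_inv_into_f_f)
  have t: "t i < ?n" "t i \<noteq> i" "t (t i) \<noteq> i" if "i < ?n" for i
    using that assms(2) by (auto simp: t_def)
  have "h (t (g a)) \<in> A \<and> h (t (g a)) \<noteq> a \<and> h (t (g (h (t (g a))))) \<noteq> a" if "a \<in> A" for a
  proof -
    obtain i where i: "i < ?n" "a = h i" using h \<open>a \<in> A\<close> unfolding bij_betw_def by auto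
    then show ?thesis using t[OF i(1)] t(1)[OF t(1)[OF i(1)]] hA gh by metis
  qed
  then show ?thesis by (intro exI[of _ "\<lambda>a. h (t (g a))"]) simp
qed

section \<open>Triple systems with a prescribed edge intersection hypergraph\<close>

text \<open>Distinct triples meet in at most two points, so every relevant intersection is a pair.
  By \<open>sep\<close> such a pair is an edge, and by \<open>cov\<close> every edge is the
  intersection of two triples.\<close>

lemma EI_3_uniformI:
  assumes T: "simple_graph T"
    and F: "\<And>f. f \<in> F \<Longrightarrow> f \<subseteq> verts T \<and> card f = 3"
    and cov: "\<And>e. e \<in> edges T \<Longrightarrow> \<exists>f\<in>F. \<exists>g\<in>F. f \<noteq> g \<and> e \<subseteq> f \<and> e \<subseteq> g"
    and sep: "\<And>f g a b. \<lbrakk>f \<in> F; g \<in> F; a \<noteq> b; {a, b} \<subseteq> f; {a, b} \<subseteq> g; {a, b} \<notin> edges T\<rbrakk> \<Longrightarrow> f = g"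
  shows "uniform_hypergraph 3 (verts T, F) \<and> EI (verts T, F) = T"
proof
  show "uniform_hypergraph 3 (verts T, F)"
    using T F by (auto simp: simple_graph_def uniform_hypergraph_def hypergraph_def)
  have inter: "card (f \<inter> g) \<le> 2" "finite (f \<inter> g)" if "f \<in> F" "g \<in> F" "f \<noteq> g" for f g
  proof -
    have fin: "finite f" "finite g" using F that by (auto intro: card_ge_0_finite)
    then show "finite (f \<inter> g)" by simp
    \<comment> \<open>If \<open>f\<close> were contained in \<open>g\<close>, equal cardinalities
      would give \<open>f = g\<close>.\<close>
    have "f \<inter> g \<subset> f"
      using that fin F by (metis card_subset_eq inf_le1 inf.absorb_iff1 psubsetI)
    then have "card (f \<inter> g) < card f" using fin by (simp add: psubset_card_mono)
    then show "card (f \<inter> g) \<le> 2" using F that by fastforce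
  qed
  have "{f \<inter> g |f g. f \<in> F \<and> g \<in> F \<and> f \<noteq> g \<and> 2 \<le> card (f \<inter> g)} = edges T"
  proof (intro equalityI subsetI)
    fix e assume "e \<in> {f \<inter> g |f g. f \<in> F \<and> g \<in> F \<and> f \<noteq> g \<and> 2 \<le> card (f \<inter> g)}"
    then obtain f g where e: "e = f \<inter> g" "f \<in> F" "g \<in> F" "f \<noteq> g" "2 \<le> card e" by blast
    then have "card e = 2" using inter by (simp add: le_antisym)
    then obtain a b where "e = {a, b}" "a \<noteq> b" by (auto simp: card_2_iff)
    then show "e \<in> edges T" using sep[of f g a b] e by blast
  next
    fix e assume "e \<in> edges T"
    then have "card e = 2" using T by (auto simp: simple_graph_def uniform_hypergraph_def)
    obtain f g where fg: "f \<in> F" "g \<in> F" "f \<noteq> g" "e \<subseteq> f \<inter> g"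
      using cov[OF \<open>e \<in> edges T\<close>] by blast
    then have "e = f \<inter> g"
      using inter[OF fg(1-3)] \<open>card e = 2\<close> by (metis card_seteq)
    then show "e \<in> {f \<inter> g |f g. f \<in> F \<and> g \<in> F \<and> f \<noteq> g \<and> 2 \<le> card (f \<inter> g)}"
      using fg \<open>card e = 2\<close> by (metis (mono_tags, lifting) CollectI order_refl)
  qed
  then show "EI (verts T, F) = T" by (simp add: EI_def)
qed

section \<open>Connectedness, neighbourhoods and short cycles\<close>

text \<open>A walk starting in \<open>S\<close> never leaves it. This is how the vertex set of a
  small tree is read off from its neighbourhoods.\<close>

lemma connected_graph_closed_set:
  assumes "connected_graph G" "s \<in> S" "s \<in> verts G"
    and closed: "\<And>u v. u \<in> S \<Longrightarrow> {u, v} \<in> edges G \<Longrightarrow> v \<in> S"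
  shows "verts G \<subseteq> S"
proof
  have walk_in: "walk G xs \<Longrightarrow> hd xs \<in> S \<Longrightarrow> last xs \<in> S" for xs
  proof (induction xs)
    case (Cons x xs)
    show ?case
    proof (cases xs)
      case Nil
      then show ?thesis using Cons.prems by simp
    next
      case (Cons y ys)
      then show ?thesis using Cons.IH Cons.prems closed[of x y] by (simp add: walk_def)
    qed
  qed (simp add: walk_def)
  fix v assume "v \<in> verts G"
  then show "v \<in> S" using assms(1-3) walk_in unfolding connected_graph_def by metis
qed

locale tree_graph =
  fixes T :: "'a hypergraph"
  assumes tree: "tree T"
begin

definition nbrs :: "'a \<Rightarrow> 'a set" where
  "nbrs v = {u. {u, v} \<in> edges T}"

text \<open>The third argument names the other neighbour of \<open>v\<close>. The vertices at
  distance at most 2 from \<open>v\<close> are then \<open>l\<close>, \<open>v\<close>,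
  \<open>x\<close> and the neighbours of \<open>x\<close>, so being far from \<open>v\<close> is
  expressed through \<open>x\<close>.\<close>

definition pendant :: "'a \<Rightarrow> 'a \<Rightarrow> 'a \<Rightarrow> bool" where
  "pendant l v x \<longleftrightarrow> nbrs l = {v} \<and> nbrs v = {l, x} \<and> l \<noteq> x"

text \<open>
  \<open>R\<close> collects pairs \<open>{a, b}\<close> with a common neighbour whose cherry is left out.
\<close>

definition removable :: "'a set set \<Rightarrow> bool" where
  "removable R \<longleftrightarrow>
     (\<forall>v a. a \<in> nbrs v \<and> 3 \<le> card (nbrs v) \<longrightarrow>
        (\<exists>b c. b \<noteq> c \<and> {b, c} \<subseteq> nbrs v - {a} \<and> {a, b} \<notin> R \<and> {a, c} \<notin> R)) \<and>
     (\<forall>v a b. nbrs v = {a, b} \<and> a \<noteq> b \<longrightarrow> {a, b} \<notin> R)"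

lemma simple: "simple_graph T" and connected: "connected_graph T" and acyclic: "\<not> cycle_in T xs"
  using tree by (auto simp: tree_def)

lemma edgeD: "{u, v} \<in> edges T \<Longrightarrow> u \<in> verts T \<and> v \<in> verts T \<and> u \<noteq> v"
  using simple unfolding simple_graph_def uniform_hypergraph_def hypergraph_def
  by (metis card_2_iff doubleton_eq_iff insert_subset)

lemma nbrs_sym: "u \<in> nbrs v \<longleftrightarrow> v \<in> nbrs u"
  by (simp add: nbrs_def insert_commute)

lemma nbrs_irrefl: "v \<notin> nbrs v"
  using edgeD[of v v] by (auto simp: nbrs_def)

lemma nbrs_verts: "u \<in> nbrs v \<Longrightarrow> u \<in> verts T" "u \<in> nbrs v \<Longrightarrow> v \<in> verts T"
  using edgeD by (auto simp: nbrs_def)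

lemma finite_verts: "finite (verts T)"
  using simple by (simp add: simple_graph_def uniform_hypergraph_def hypergraph_def)

lemma finite_nbrs: "finite (nbrs v)"
  by (rule finite_subset[OF _ finite_verts]) (auto dest: nbrs_verts)

lemma edge_iff: "{u, v} \<in> edges T \<longleftrightarrow> u \<in> nbrs v"
  by (simp add: nbrs_def)

lemma edges_nbrs: "e \<in> edges T \<longleftrightarrow> (\<exists>u v. e = {u, v} \<and> u \<in> nbrs v)"
  using simple unfolding simple_graph_def uniform_hypergraph_def nbrs_def
  by (metis card_2_iff mem_Collect_eq)

lemma no_triangle: "a \<in> nbrs b \<Longrightarrow> b \<in> nbrs c \<Longrightarrow> a \<notin> nbrs c"
proof
  assume *: "a \<in> nbrs b" "b \<in> nbrs c" "a \<in> nbrs c"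
  then have "cycle_in T [a, b, c]"
    using nbrs_irrefl nbrs_verts nbrs_sym
    unfolding cycle_in_def walk_def by (auto simp: edge_iff)
  then show False using acyclic by blast
qed

lemma common_nbr_unique:
  assumes "a \<noteq> b" "a \<in> nbrs u" "b \<in> nbrs u" "a \<in> nbrs v" "b \<in> nbrs v"
  shows "u = v"
proof (rule ccontr)
  assume "u \<noteq> v"
  then have "cycle_in T [a, u, b, v]"
    using assms nbrs_irrefl nbrs_verts nbrs_sym
    unfolding cycle_in_def walk_def by (auto simp: edge_iff)
  then show False using acyclic by blast
qed

lemma verts_subset_closed:
  assumes "s \<in> S" "s \<in> verts T" "\<And>u. u \<in> S \<Longrightarrow> nbrs u \<subseteq> S"
  shows "verts T \<subseteq> S"
proof (rule connected_graph_closed_set[OF connected assms(1,2)])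
  fix u v assume "u \<in> S" "{u, v} \<in> edges T"
  then show "v \<in> S" using assms(3)[of u] nbrs_sym[of u v] by (auto simp: edge_iff)
qed

lemma edges_conv: "edges T = (\<Union>v\<in>verts T. (\<lambda>u. {u, v}) ` nbrs v)"
proof (intro equalityI subsetI)
  fix e assume "e \<in> edges T"
  then obtain u v where "e = {u, v}" "u \<in> nbrs v" using edges_nbrs[of e] by auto
  then show "e \<in> (\<Union>v\<in>verts T. (\<lambda>u. {u, v}) ` nbrs v)" using nbrs_verts(2) by auto
qed (auto simp: edge_iff)

lemma pendant_unique: "pendant l v x \<Longrightarrow> pendant l v' x' \<Longrightarrow> v = v' \<and> x = x'"
  by (auto simp: pendant_def doubleton_eq_iff)

lemma pendant_distinct: "pendant l v x \<Longrightarrow> l \<noteq> v \<and> v \<noteq> x \<and> l \<noteq> x"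
  unfolding pendant_def using nbrs_irrefl by blast

lemma pendant_in: "pendant l v x \<Longrightarrow> l \<in> verts T \<and> v \<in> verts T \<and> x \<in> verts T"
  unfolding pendant_def using nbrs_verts by blast

lemma pendant_support: "pendant l v x \<Longrightarrow> v \<in> nbrs x"
  using nbrs_sym[of v x] by (simp add: pendant_def)

lemma pendant_leaf_not_support: "pendant l v x \<Longrightarrow> pendant l' v' x' \<Longrightarrow> l \<noteq> v'"
  unfolding pendant_def by (metis doubleton_eq_iff insert_absorb2)

lemma cherries_and_extra_triples:
  assumes no_P2: "\<And>u v. nbrs u = {v} \<Longrightarrow> nbrs v \<noteq> {u}"
    and support_inj: "\<And>l l' v x x'. pendant l v x \<Longrightarrow> pendant l' v x' \<Longrightarrow> l = l'"
    and w: "\<And>l v x. pendant l v x \<Longrightarrow>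
        w l \<in> verts T \<and> w l \<notin> {l, v, x} \<and> (w l \<in> nbrs x \<longrightarrow> {v, w l} \<in> R)"
    and clash: "\<And>l v x l' v' x'. \<lbrakk>pendant l v x; pendant l' v' x'; l \<noteq> l'; w l \<in> {l', v'}\<rbrakk>
        \<Longrightarrow> w l' \<notin> {l, v}"
    and R: "removable R"
  shows "\<exists>H. uniform_hypergraph 3 H \<and> verts H = verts T \<and> EI H = T"
proof -
  have R3: "\<exists>b c. b \<noteq> c \<and> {b, c} \<subseteq> nbrs v - {a} \<and> {a, b} \<notin> R \<and> {a, c} \<notin> R"
    if "a \<in> nbrs v" "3 \<le> card (nbrs v)" for v a
    using R that unfolding removable_def by blast
  have R2: "{a, b} \<notin> R" if "nbrs v = {a, b}" "a \<noteq> b" for v a b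
    using R that unfolding removable_def by blast
  define C where "C = {{a, v, b} |a v b. a \<in> nbrs v \<and> b \<in> nbrs v \<and> a \<noteq> b \<and> {a, b} \<notin> R}"
  define D where "D = {{l, v, w l} |l v x. pendant l v x}"
  have CI: "{a, v, b} \<in> C \<union> D" if "a \<in> nbrs v" "b \<in> nbrs v" "a \<noteq> b" "{a, b} \<notin> R" for a v b
    using that unfolding C_def by blast
  have twoI: "\<exists>f\<in>C \<union> D. \<exists>g\<in>C \<union> D. f \<noteq> g \<and> e \<subseteq> f \<and> e \<subseteq> g"
    if "f \<noteq> g" "f \<in> C \<union> D" "g \<in> C \<union> D" "e \<subseteq> f" "e \<subseteq> g" for e f g
    using that by blast
  have triple: "f \<subseteq> verts T \<and> card f = 3" if "f \<in> C \<union> D" for f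
    using that
  proof
    assume "f \<in> C"
    then show ?thesis unfolding C_def using nbrs_irrefl nbrs_verts by (auto simp: card_insert_if)
  next
    assume "f \<in> D"
    then obtain l v x where "pendant l v x" "f = {l, v, w l}" unfolding D_def by blast
    then show ?thesis using w[of l v x] pendant_distinct[of l v x] pendant_in[of l v x]
      by (auto simp: card_insert_if)
  qed
  have cov3: "\<exists>f\<in>C \<union> D. \<exists>g\<in>C \<union> D. f \<noteq> g \<and> {u, v} \<subseteq> f \<and> {u, v} \<subseteq> g"
    if uv: "u \<in> nbrs v" and v3: "3 \<le> card (nbrs v)" for u v
  proof -
    obtain b c where bc: "b \<noteq> c" "b \<in> nbrs v" "c \<in> nbrs v" "b \<noteq> u" "c \<noteq> u" "{u, b} \<notin> R" "{u, c} \<notin> R"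
      using R3[OF uv v3] by blast
    have "b \<noteq> v" using bc nbrs_irrefl by blast
    then have "{u, v, b} \<noteq> {u, v, c}" using bc by blast
    moreover have "{u, v, b} \<in> C \<union> D" "{u, v, c} \<in> C \<union> D" using CI[of u v] bc uv by auto
    ultimately show ?thesis by (rule twoI) auto
  qed
  have card2: "\<exists>y. S = {z, y} \<and> z \<noteq> y" if "card S = 2" "z \<in> S" for S and z :: 'a
    using that unfolding card_2_iff by blast
  have cov_pendant: "\<exists>f\<in>C \<union> D. \<exists>g\<in>C \<union> D. f \<noteq> g \<and> {u, v} \<subseteq> f \<and> {u, v} \<subseteq> g"
    if uv: "nbrs u = {v}" and v2: "card (nbrs v) = 2" for u v
  proof -
    have "u \<in> nbrs v" using uv nbrs_sym[of u v] by simp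
    then obtain x where x: "nbrs v = {u, x}" "u \<noteq> x" using card2[OF v2] by blast
    then have p: "pendant u v x" using uv by (simp add: pendant_def)
    have "{u, v, x} \<noteq> {u, v, w u}"
      using w[OF p] pendant_distinct[OF p] by auto
    moreover have "{u, v, x} \<in> C \<union> D" using CI[of u v x] x R2[OF x] by simp
    moreover have "{u, v, w u} \<in> C \<union> D" using p unfolding D_def by blast
    ultimately show ?thesis by (rule twoI) auto
  qed
  have cov: "\<exists>f\<in>C \<union> D. \<exists>g\<in>C \<union> D. f \<noteq> g \<and> e \<subseteq> f \<and> e \<subseteq> g" if e: "e \<in> edges T" for e
  proof -
    obtain u v where uv: "e = {u, v}" "u \<in> nbrs v" using e edges_nbrs by blast
    then have vu: "v \<in> nbrs u" using nbrs_sym[of u v] by simp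
    have pos: "card (nbrs u) > 0" "card (nbrs v) > 0"
      using uv vu finite_nbrs by (auto simp: card_gt_0_iff)
    have leaf: "nbrs p = {q}" if "card (nbrs p) = 1" "q \<in> nbrs p" for p q
      using that by (auto simp: card_1_singleton_iff)
    consider "3 \<le> card (nbrs v)" | "3 \<le> card (nbrs u)" | "card (nbrs u) = 1" "card (nbrs v) = 1"
      | "card (nbrs u) = 1" "card (nbrs v) = 2" | "card (nbrs v) = 1" "card (nbrs u) = 2"
      | "card (nbrs u) = 2" "card (nbrs v) = 2"
      using pos by linarith
    then show ?thesis
    proof cases
      case 1
      then show ?thesis using cov3[of u v] uv by simp
    next
      case 2
      then show ?thesis using cov3[of v u] vu unfolding uv by (simp add: insert_commute)
    next
      case 3
      then show ?thesis using leaf[OF _ vu] leaf[OF _ uv(2)] no_P2[of u v] by simp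
    next
      case 4
      then show ?thesis using cov_pendant[of u v] leaf[OF _ vu] unfolding uv(1) by simp
    next
      case 5
      then show ?thesis using cov_pendant[of v u] leaf[OF _ uv(2)] unfolding uv(1)
        by (simp add: insert_commute[of u v])
    next
      case 6
      obtain a where a: "nbrs u = {v, a}" "v \<noteq> a" using card2[OF 6(1) vu] by blast
      obtain b where b: "nbrs v = {u, b}" "u \<noteq> b" using card2[OF 6(2) uv(2)] by blast
      have "a \<noteq> b" using no_triangle[of a u v] a b uv by blast
      have "a \<noteq> u" using a nbrs_irrefl[of u] by blast
      then have "{v, u, a} \<noteq> {u, v, b}" using \<open>a \<noteq> b\<close> a by blast
      moreover have "{v, u, a} \<in> C \<union> D" using CI[of v u a] a R2[OF a] by simp
      moreover have "{u, v, b} \<in> C \<union> D" using CI[of u v b] b R2[OF b] by simp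
      ultimately show ?thesis unfolding uv(1) by (rule twoI) auto
    qed
  qed
  have cherry: "\<exists>v. p \<in> nbrs v \<and> q \<in> nbrs v \<and> f = {p, v, q} \<and> {p, q} \<notin> R"
    if fC: "f \<in> C" and pq: "p \<noteq> q" "{p, q} \<subseteq> f" "{p, q} \<notin> edges T" for f p q
  proof -
    obtain a v b where f: "f = {a, v, b}" "a \<in> nbrs v" "b \<in> nbrs v" "{a, b} \<notin> R"
      using fC unfolding C_def by blast
    have "p \<noteq> v" "q \<noteq> v"
      using pq f nbrs_sym[of v] by (auto simp: edge_iff)
    then have "{p, q} = {a, b}" using pq f by blast
    then show ?thesis using f by (intro exI[of _ v]) (auto simp: doubleton_eq_iff insert_commute)
  qed
  have extra: "\<exists>l v x. pendant l v x \<and> f = {l, v, w l} \<and> ({p, q} = {l, w l} \<or> {p, q} = {v, w l})"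
    if fD: "f \<in> D" and pq: "p \<noteq> q" "{p, q} \<subseteq> f" "{p, q} \<notin> edges T" for f p q
  proof -
    obtain l v x where f: "pendant l v x" "f = {l, v, w l}" using fD unfolding D_def by blast
    have "{l, v} \<in> edges T" using f by (auto simp: edge_iff pendant_def)
    then have "{p, q} \<noteq> {l, v}" using pq(3) by metis
    then have "{p, q} = {l, w l} \<or> {p, q} = {v, w l}" using pq(1,2) f(2) by blast
    then show ?thesis using f by blast
  qed
  have CD: False if fg: "f \<in> C" "g \<in> D" "p \<noteq> q" "{p, q} \<subseteq> f" "{p, q} \<subseteq> g" "{p, q} \<notin> edges T" for f g p q
  proof -
    obtain m where m: "p \<in> nbrs m" "q \<in> nbrs m" "{p, q} \<notin> R" using cherry[of f p q] fg by blast
    obtain l v x where p: "pendant l v x" and pq: "{p, q} = {l, w l} \<or> {p, q} = {v, w l}"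
      using extra[of g p q] fg by blast
    note * = w[OF p] pendant_distinct[OF p]
    from pq show False
    proof
      assume "{p, q} = {l, w l}"
      then have "l \<in> nbrs m" "w l \<in> nbrs m" using m by (auto simp: doubleton_eq_iff)
      then have "m = v" using p nbrs_sym[of l m] by (simp add: pendant_def)
      then show False using p * \<open>w l \<in> nbrs m\<close> by (auto simp: pendant_def)
    next
      assume vw: "{p, q} = {v, w l}"
      then have "v \<in> nbrs m" "w l \<in> nbrs m" using m by (auto simp: doubleton_eq_iff)
      then have "m = l \<or> m = x" using p nbrs_sym[of v m] by (simp add: pendant_def)
      then show False using p * \<open>w l \<in> nbrs m\<close> m vw by (auto simp: pendant_def)
    qed
  qed
  have sep: "f = g" if fg: "f \<in> C \<union> D" "g \<in> C \<union> D" "p \<noteq> q" "{p, q} \<subseteq> f" "{p, q} \<subseteq> g" "{p, q} \<notin> edges T"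
    for f g p q
  proof -
    consider "f \<in> C" "g \<in> C" | "f \<in> D" "g \<in> D" using fg CD[of f g p q] CD[of g f p q] by blast
    then show ?thesis
    proof cases
      case 1
      then show ?thesis using cherry[of f p q] cherry[of g p q] fg common_nbr_unique[of p q] by metis
    next
      case 2
      obtain l v x where f: "pendant l v x" "f = {l, v, w l}"
          "{p, q} = {l, w l} \<or> {p, q} = {v, w l}"
        using extra[of f p q] fg 2 by blast
      obtain l' v' x' where g: "pendant l' v' x'" "g = {l', v', w l'}"
          "{p, q} = {l', w l'} \<or> {p, q} = {v', w l'}"
        using extra[of g p q] fg 2 by blast
      show ?thesis
      proof (cases "l = l'")
        case True
        then show ?thesis using f g pendant_unique by blast
      next
        case False
        have "v \<noteq> v'" using support_inj f(1) g(1) False by blast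
        moreover have "l \<noteq> v'" "l' \<noteq> v" using pendant_leaf_not_support f(1) g(1) by blast+
        ultimately have "w l \<in> {l', v'}" "w l' \<in> {l, v}"
          using f(3) g(3) False by (auto simp: doubleton_eq_iff)
        then show ?thesis using clash[OF f(1) g(1) False] by blast
      qed
    qed
  qed
  have "uniform_hypergraph 3 (verts T, C \<union> D) \<and> EI (verts T, C \<union> D) = T"
    by (rule EI_3_uniformI[OF simple triple cov sep])
  then show ?thesis by (intro exI[of _ "(verts T, C \<union> D)"]) simp
qed

lemma two_elements:
  assumes "2 \<le> card S"
  shows "\<exists>b c. b \<noteq> c \<and> {b, c} \<subseteq> S"
  using obtain_subset_with_card_n[OF assms] by (metis card_2_iff)

lemma removable_empty: "removable {}"
proof -
  have "\<exists>b c. b \<noteq> c \<and> {b, c} \<subseteq> nbrs v - {a}" if "a \<in> nbrs v" "3 \<le> card (nbrs v)" for a v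
    using that by (intro two_elements) (simp add: card_Diff_singleton)
  then show ?thesis unfolding removable_def by blast
qed

lemma removable_pair:
  assumes p: "p \<in> nbrs x" and q: "q \<in> nbrs x" and "p \<noteq> q" and "4 \<le> card (nbrs x)"
  shows "removable {{p, q}}"
  unfolding removable_def
proof (intro conjI allI impI)
  fix v a assume a: "a \<in> nbrs v \<and> 3 \<le> card (nbrs v)"
  define c where "c = (if a = p then q else p)"
  let ?S = "if v = x then nbrs v - {a, c} else nbrs v - {a}"
  have "2 \<le> card ?S"
  proof (cases "v = x")
    case True
    have "card (nbrs x) - card {a, c} \<le> card (nbrs x - {a, c})"
      by (rule diff_card_le_card_Diff) simp
    moreover have "card {a, c} \<le> 2" by (simp add: card_insert_if)
    ultimately show ?thesis using True assms(4) by simp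
  next
    case False
    then show ?thesis using a by (auto simp: card_Diff_singleton)
  qed
  then obtain b d where bd: "b \<noteq> d" "{b, d} \<subseteq> ?S" using two_elements by blast
  have ok: "y \<in> nbrs v - {a} \<and> {a, y} \<noteq> {p, q}" if "y \<in> ?S" for y
  proof (cases "v = x")
    case True
    then show ?thesis using that by (auto simp: c_def doubleton_eq_iff split: if_splits)
  next
    case False
    then show ?thesis
      using that a p q \<open>p \<noteq> q\<close> common_nbr_unique[of p q v x] by (auto simp: doubleton_eq_iff)
  qed
  have "b \<in> ?S" "d \<in> ?S" using bd(2) by (simp_all only: insert_subset)
  from ok[OF this(1)] ok[OF this(2)] bd(1)
  show "\<exists>b c. b \<noteq> c \<and> {b, c} \<subseteq> nbrs v - {a} \<and> {a, b} \<notin> {{p, q}} \<and> {a, c} \<notin> {{p, q}}"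
    by (intro exI[of _ b] exI[of _ d]) simp
next
  fix v a b assume v: "nbrs v = {a, b} \<and> a \<noteq> b"
  then have "card (nbrs v) = 2" by simp
  then have "v \<noteq> x" using assms(4) by auto
  then have "nbrs v \<noteq> {p, q}" using p q \<open>p \<noteq> q\<close> common_nbr_unique[of p q v x] by auto
  then show "{a, b} \<notin> {{p, q}}" using v by simp
qed

lemma isomorphic_P2:
  assumes "nbrs u = {v}" "nbrs v = {u}"
  shows "isomorphic T (path_graph 2)"
proof -
  have "u \<in> verts T" "v \<in> verts T" "u \<noteq> v" using assms nbrs_verts nbrs_irrefl by blast+
  moreover have "verts T \<subseteq> {u, v}"
    using verts_subset_closed[of u] assms \<open>u \<in> verts T\<close> by auto
  ultimately have "verts T = {u, v}" by blast
  then have "edges T = {{u, v}}" by (simp add: edges_conv assms insert_commute)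
  then show ?thesis
    using isomorphic_path_graph[of "[u, v]" T] \<open>verts T = {u, v}\<close> \<open>u \<noteq> v\<close>
    by (simp add: numeral_eq_Suc)
qed

lemma isomorphic_P3:
  assumes l: "pendant l v x" and l': "pendant l' v x'" and "l \<noteq> l'"
  shows "isomorphic T (path_graph 3)"
proof -
  have nb: "nbrs l = {v}" "nbrs v = {l, l'}" "nbrs l' = {v}"
    using assms by (auto simp: pendant_def)
  have V: "verts T = {l, v, l'}"
    using verts_subset_closed[of l "{l, v, l'}"] nb pendant_in[OF l] pendant_in[OF l'] by auto
  have E: "edges T = {{l, v}, {v, l'}}"
    by (simp add: edges_conv V nb insert_commute)
  have "distinct [l, v, l']" using pendant_distinct[OF l] pendant_distinct[OF l'] \<open>l \<noteq> l'\<close> by auto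
  then show ?thesis
    using isomorphic_path_graph[of "[l, v, l']" T] V E by (simp add: numeral_eq_Suc)
qed

lemma isomorphic_P4:
  assumes l: "pendant l v x" and l': "pendant l' x x'"
  shows "isomorphic T (path_graph 4)"
proof -
  have "v \<in> nbrs x" using pendant_support[OF l] .
  moreover have "v \<noteq> l'" using pendant_leaf_not_support[OF l' l] by blast
  ultimately have nb: "nbrs l = {v}" "nbrs v = {l, x}" "nbrs x = {v, l'}" "nbrs l' = {x}"
    using assms by (auto simp: pendant_def)
  have "l \<noteq> l'" using nb pendant_distinct[OF l] by auto
  have V: "verts T = {l, v, x, l'}"
    using verts_subset_closed[of l "{l, v, x, l'}"] nb pendant_in[OF l] pendant_in[OF l'] by auto
  have E: "edges T = {{l, v}, {v, x}, {x, l'}}"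
    by (simp add: edges_conv V nb insert_commute)
  have "distinct [l, v, x, l']" using pendant_distinct[OF l] pendant_distinct[OF l'] \<open>l \<noteq> l'\<close> \<open>v \<noteq> l'\<close> by auto
  then show ?thesis
    using isomorphic_path_graph[of "[l, v, x, l']" T] V E by (simp add: numeral_eq_Suc)
qed

lemma isomorphic_P6:
  assumes l: "pendant l v x" and l': "pendant l' v' x'"
    and vv': "v \<noteq> v'" "x \<noteq> v'" and "x \<noteq> x'"
    and near: "verts T \<subseteq> {l, v, l', v', x} \<union> nbrs x" "verts T \<subseteq> {l, v, l', v', x'} \<union> nbrs x'"
  shows "isomorphic T (path_graph 6)"
proof -
  have nb: "nbrs l = {v}" "nbrs v = {l, x}" "nbrs l' = {v'}" "nbrs v' = {l', x'}"
    using l l' by (auto simp: pendant_def)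
  have vx: "v \<in> nbrs x" "v' \<in> nbrs x'" using pendant_support l l' by blast+
  have ne: "l \<noteq> l'" "l \<noteq> v'" "l' \<noteq> v"
    using nb vv' pendant_leaf_not_support l l' by blast+
  have "x \<noteq> l'" using nb vx vv' by auto
  have "x' \<noteq> l" using nb vx vv' by auto
  have "x' \<noteq> v" using nb vx vv' ne by auto
  note D = pendant_distinct[OF l] pendant_distinct[OF l'] vv' \<open>x \<noteq> x'\<close> ne
    \<open>x \<noteq> l'\<close> \<open>x' \<noteq> l\<close> \<open>x' \<noteq> v\<close>
  have "x \<in> nbrs x'" using near(2) pendant_in[OF l] D by blast
  then have xx': "x \<in> nbrs x'" "x' \<in> nbrs x" using nbrs_sym[of x x'] by simp_all
  have V: "verts T = {l, v, x, x', v', l'}"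
  proof
    show "verts T \<subseteq> {l, v, x, x', v', l'}"
    proof
      fix y assume y: "y \<in> verts T"
      show "y \<in> {l, v, x, x', v', l'}"
        using near y no_triangle[of y x x'] xx' by blast
    qed
  qed (use pendant_in[OF l] pendant_in[OF l'] in auto)
  have "nbrs x \<subseteq> {v, x'}"
  proof
    fix y assume y: "y \<in> nbrs x"
    then have "y \<in> {l, v, x, x', v', l'}" "x \<in> nbrs y"
      using V nbrs_verts nbrs_sym[of x y] by blast+
    then show "y \<in> {v, x'}" using y nbrs_irrefl nb D by auto
  qed
  moreover have "nbrs x' \<subseteq> {v', x}"
  proof
    fix y assume y: "y \<in> nbrs x'"
    then have "y \<in> {l, v, x, x', v', l'}" "x' \<in> nbrs y"
      using V nbrs_verts nbrs_sym[of x' y] by blast+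
    then show "y \<in> {v', x}" using y nbrs_irrefl nb D by auto
  qed
  ultimately have nx: "nbrs x = {v, x'}" "nbrs x' = {v', x}" using vx xx' by auto
  have E: "edges T = {{l, v}, {v, x}, {x, x'}, {x', v'}, {v', l'}}"
    by (simp add: edges_conv V nb nx insert_commute)
  have "distinct [l, v, x, x', v', l']" using D by auto
  then show ?thesis
    using isomorphic_path_graph[of "[l, v, x, x', v', l']" T] V E by (simp add: numeral_eq_Suc)
qed

lemma leaf_if_near:
  assumes l: "pendant l v x" and a: "a \<in> nbrs x" "a \<noteq> v" "a \<notin> B"
    and near: "verts T \<subseteq> {l, v, x} \<union> B \<union> nbrs x"
    and B: "\<And>b. b \<in> B \<Longrightarrow> nbrs b \<subseteq> insert x B"
  shows "nbrs a = {x}"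
proof -
  have "y = x" if y: "y \<in> nbrs a" for y
  proof -
    have ay: "a \<in> nbrs y" "y \<in> verts T" using y nbrs_sym[of a y] nbrs_verts by blast+
    have "a \<noteq> x" using a nbrs_irrefl by blast
    have "x \<in> nbrs a" using a nbrs_sym[of x a] by simp
    have "y \<noteq> l" using l ay a by (auto simp: pendant_def)
    moreover have "y \<noteq> v"
    proof
      assume "y = v"
      then have "a = l" using l ay \<open>a \<noteq> x\<close> by (auto simp: pendant_def)
      then show False using l \<open>x \<in> nbrs a\<close> pendant_distinct[OF l] by (auto simp: pendant_def)
    qed
    moreover have "y \<notin> B" using B[of y] ay a \<open>a \<noteq> x\<close> by blast
    moreover have "y \<notin> nbrs x" using no_triangle[OF y a(1)] .
    ultimately show ?thesis using near ay by blast
  qed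
  moreover have "x \<in> nbrs a" using a nbrs_sym[of x a] by simp
  ultimately show ?thesis by blast
qed

lemma T7_or_large_degree:
  assumes l: "pendant l v x" and only: "\<And>l' v' x'. pendant l' v' x' \<Longrightarrow> l' = l"
    and near: "verts T \<subseteq> {l, v, x} \<union> nbrs x"
  shows "isomorphic T T7 \<or> 4 \<le> card (nbrs x)"
proof -
  define A where "A = nbrs x - {v}"
  have "v \<in> nbrs x" using pendant_support[OF l] .
  then have nx: "nbrs x = insert v A" "v \<notin> A" by (auto simp: A_def)
  have finA: "finite A" using finite_nbrs by (simp add: A_def)
  have leaf: "nbrs a = {x}" if "a \<in> A" for a
    using that leaf_if_near[OF l, of a "{}"] near by (auto simp: A_def)
  have "l \<notin> A" using leaf[of l] l pendant_distinct[OF l] by (auto simp: pendant_def)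
  have "A \<noteq> {}"
  proof
    assume "A = {}"
    then have "pendant x v l" using nx l by (auto simp: pendant_def)
    then show False using only pendant_distinct[OF l] by blast
  qed
  moreover have "card A \<noteq> 1"
  proof
    assume "card A = 1"
    then obtain a where a: "A = {a}" by (auto simp: card_1_singleton_iff)
    then have "pendant a x v" using nx leaf[of a] by (auto simp: pendant_def)
    then show False using only a \<open>l \<notin> A\<close> by blast
  qed
  moreover have "isomorphic T T7" if A2: "card A = 2"
  proof -
    obtain a b where ab: "A = {a, b}" "a \<noteq> b" using A2 by (meson card_2_iff)
    have nb: "nbrs l = {v}" "nbrs v = {l, x}" "nbrs a = {x}" "nbrs b = {x}" "nbrs x = {v, a, b}"
      using l leaf nx ab by (auto simp: pendant_def)
    have "a \<noteq> x" "b \<noteq> x" using nb nbrs_irrefl[of x] by auto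
    have V: "verts T = {a, x, b, v, l}"
    proof
      show "verts T \<subseteq> {a, x, b, v, l}" using near nb by auto
      show "{a, x, b, v, l} \<subseteq> verts T" using pendant_in[OF l] nbrs_verts[of _ x] nb by auto
    qed
    have E: "edges T = {{a, x}, {x, b}, {x, v}, {v, l}}"
      by (simp add: edges_conv V nb insert_commute)
    have "distinct [a, x, b, v, l]"
      using ab nx(2) \<open>l \<notin> A\<close> pendant_distinct[OF l] \<open>a \<noteq> x\<close> \<open>b \<noteq> x\<close> by auto
    then show ?thesis
      by (rule isomorphic_listI) (simp_all add: V E T7_def insert_commute)
  qed
  moreover have "card A \<noteq> 0" using \<open>A \<noteq> {}\<close> finA by simp
  moreover have "card (nbrs x) = Suc (card A)" using nx finA by simp
  ultimately show ?thesis by linarith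
qed

lemma P5_or_T12_or_large_degree:
  assumes l: "pendant l v x" and l': "pendant l' v' x" and vv': "v \<noteq> v'"
    and near: "verts T \<subseteq> {l, v, l', v', x} \<union> nbrs x"
  shows "isomorphic T (path_graph 5) \<or> isomorphic T T12 \<or> 4 \<le> card (nbrs x)"
proof -
  define A where "A = nbrs x - {v, v'}"
  have "v \<in> nbrs x" "v' \<in> nbrs x" using pendant_support l l' by blast+
  then have nx: "nbrs x = {v, v'} \<union> A" "v \<notin> A" "v' \<notin> A" by (auto simp: A_def)
  have finA: "finite A" using finite_nbrs by (simp add: A_def)
  have nb: "nbrs l = {v}" "nbrs v = {l, x}" "nbrs l' = {v'}" "nbrs v' = {l', x}"
    using l l' by (auto simp: pendant_def)
  have lA: "l \<notin> A" "l' \<notin> A"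
    using nb pendant_distinct[OF l] pendant_distinct[OF l'] nbrs_sym[of l x] nbrs_sym[of l' x]
    by (auto simp: A_def)
  have leaf: "nbrs a = {x}" if "a \<in> A" for a
  proof (rule leaf_if_near[OF l, of a "{l', v'}"])
    show "a \<in> nbrs x" "a \<noteq> v" using \<open>a \<in> A\<close> by (auto simp: A_def)
    show "a \<notin> {l', v'}" using \<open>a \<in> A\<close> lA nx by auto
    show "verts T \<subseteq> {l, v, x} \<union> {l', v'} \<union> nbrs x" using near by auto
    show "nbrs b \<subseteq> insert x {l', v'}" if "b \<in> {l', v'}" for b using that nb by auto
  qed
  have D: "l \<noteq> l'" "l \<noteq> v'" "l' \<noteq> v"
    using nb vv' pendant_leaf_not_support l l' by blast+
  note D = D vv' pendant_distinct[OF l] pendant_distinct[OF l'] lA nx(2,3)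
  have "isomorphic T (path_graph 5)" if "card A = 0"
  proof -
    have "A = {}" using that finA by simp
    then have nx': "nbrs x = {v, v'}" using nx by simp
    have V: "verts T = {l, v, x, v', l'}"
      using near pendant_in[OF l] pendant_in[OF l'] nx' by auto
    have E: "edges T = {{l, v}, {v, x}, {x, v'}, {v', l'}}"
      by (simp add: edges_conv V nb nx' insert_commute)
    have "distinct [l, v, x, v', l']" using D by auto
    then show ?thesis
      using isomorphic_path_graph[of "[l, v, x, v', l']" T] V E by (simp add: numeral_eq_Suc)
  qed
  moreover have "isomorphic T T12" if A1: "card A = 1"
  proof -
    obtain a where a: "A = {a}" using A1 by (auto simp: card_1_singleton_iff)
    then have nx': "nbrs x = {v, v', a}" "nbrs a = {x}" using nx leaf by auto
    have "a \<noteq> x" using nx' nbrs_irrefl[of x] by auto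
    have V: "verts T = {a, x, v, l, v', l'}"
    proof
      show "verts T \<subseteq> {a, x, v, l, v', l'}" using near nx' by auto
      show "{a, x, v, l, v', l'} \<subseteq> verts T"
        using pendant_in[OF l] pendant_in[OF l'] nbrs_verts[of _ x] nx' by auto
    qed
    have E: "edges T = {{a, x}, {x, v}, {v, l}, {x, v'}, {v', l'}}"
      by (simp add: edges_conv V nb nx' insert_commute)
    have "distinct [a, x, v, l, v', l']"
      using D a \<open>a \<noteq> x\<close> by auto
    then show ?thesis
      by (rule isomorphic_listI) (simp_all add: V E T12_def insert_commute)
  qed
  moreover have "card (nbrs x) = 2 + card A" using nx finA vv' by simp
  ultimately show ?thesis by linarith
qed

lemma edge_intersection_of_3_uniform:
  assumes P2: "\<not> isomorphic T (path_graph 2)" and P3: "\<not> isomorphic T (path_graph 3)"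
    and P4: "\<not> isomorphic T (path_graph 4)" and P5: "\<not> isomorphic T (path_graph 5)"
    and P6: "\<not> isomorphic T (path_graph 6)"
    and T7: "\<not> isomorphic T T7" and T12: "\<not> isomorphic T T12"
  shows "\<exists>H. uniform_hypergraph 3 H \<and> verts H = verts T \<and> EI H = T"
proof -
  define L where "L = {l. \<exists>v x. pendant l v x}"
  have LI: "l \<in> L" if "pendant l v x" for l v x using that by (auto simp: L_def)
  have LD: "\<exists>v x. pendant l v x" if "l \<in> L" for l using that by (simp add: L_def)
  have "finite L"
    by (rule finite_subset[OF _ finite_verts]) (auto simp: L_def dest: pendant_in)
  have no_P2: "nbrs u = {v} \<Longrightarrow> nbrs v \<noteq> {u}" for u v
    using isomorphic_P2[of u v] P2 by blast
  have inj: "pendant l v x \<Longrightarrow> pendant l' v x' \<Longrightarrow> l = l'" for l l' v x x'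
    using isomorphic_P3[of l v x l' x'] P3 by blast
  have nonadj: "pendant l v x \<Longrightarrow> pendant l' v' x' \<Longrightarrow> x \<noteq> v'" for l l' v v' x x'
    using isomorphic_P4[of l v x l' x'] P4 by blast
  have far: "l' \<in> verts T \<and> l' \<notin> {l, v, x} \<and> l' \<notin> nbrs x"
    if l: "pendant l v x" and l': "pendant l' v' x'" and "l \<noteq> l'" for l v x l' v' x'
  proof -
    have "v \<in> nbrs x" using pendant_support[OF l] .
    then have "l' \<noteq> x" using inj[OF l] l' \<open>l \<noteq> l'\<close> by (auto simp: pendant_def)
    moreover have "l' \<noteq> v" using pendant_leaf_not_support[OF l' l] .
    moreover have "l' \<notin> nbrs x"
      using nonadj[OF l l'] l' nbrs_sym[of l' x] by (auto simp: pendant_def)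
    ultimately show ?thesis using pendant_in[OF l'] \<open>l \<noteq> l'\<close> by blast
  qed
  have construction: ?thesis
    if "\<And>l v x. pendant l v x \<Longrightarrow>
        w l \<in> verts T \<and> w l \<notin> {l, v, x} \<and> (w l \<in> nbrs x \<longrightarrow> {v, w l} \<in> R)"
      and "\<And>l v x l' v' x'. \<lbrakk>pendant l v x; pendant l' v' x'; l \<noteq> l'; w l \<in> {l', v'}\<rbrakk>
        \<Longrightarrow> w l' \<notin> {l, v}"
      and "removable R"
    for w R
    by (rule cherries_and_extra_triples[OF no_P2 inj that])
  consider "card L = 0" | "card L = 1" | "card L = 2" | "3 \<le> card L" by linarith
  then show ?thesis
  proof cases
    case 1
    then have none: "\<not> pendant l v x" for l v x using \<open>finite L\<close> LI by auto
    show ?thesis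
      by (rule construction[where w = id and R = "{}"]) (simp_all add: none removable_empty)
  next
    case 2
    then obtain l where L: "L = {l}" by (auto simp: card_1_singleton_iff)
    then obtain v x where l: "pendant l v x" using LD[of l] by blast
    have only: "pendant l' v' x' \<Longrightarrow> l' = l" for l' v' x'
      using LI[of l' v' x'] L by simp
    have fin: ?thesis
      if z: "z \<in> verts T" "z \<notin> {l, v, x}" "z \<in> nbrs x \<Longrightarrow> {v, z} \<in> R" and R: "removable R"
      for z R
    proof (rule construction[where w = "\<lambda>_. z" and R = R])
      fix l' v' x' assume "pendant l' v' x'"
      moreover from this have "l' = l" by (rule only)
      ultimately have "l' = l" "v' = v" "x' = x" using pendant_unique[OF l] by auto
      then show "z \<in> verts T \<and> z \<notin> {l', v', x'} \<and> (z \<in> nbrs x' \<longrightarrow> {v', z} \<in> R)"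
        using z by simp
    next
      fix l' v' x' l'' v'' x'' assume "pendant l' v' x'" "pendant l'' v'' x''" "l' \<noteq> l''"
      then show "z \<notin> {l', v'}" using only[of l' v' x'] only[of l'' v'' x''] by simp
    qed (rule R)
    show ?thesis
    proof (cases "verts T \<subseteq> {l, v, x} \<union> nbrs x")
      case True
      have "isomorphic T T7 \<or> 4 \<le> card (nbrs x)"
        by (rule T7_or_large_degree[OF l only True])
      then have deg: "4 \<le> card (nbrs x)" using T7 by simp
      have v: "v \<in> nbrs x" using pendant_support[OF l] .
      have "2 \<le> card (nbrs x - {v})" using deg v finite_nbrs by simp
      then obtain a where a: "a \<in> nbrs x" "a \<noteq> v" using two_elements by blast
      have "a \<noteq> x" using a nbrs_irrefl by blast
      moreover have "a \<noteq> l"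
        using a l pendant_distinct[OF l] nbrs_sym[of a x] by (auto simp: pendant_def)
      ultimately show ?thesis
        using a nbrs_verts(1)[OF a(1)]
        by (intro fin[OF _ _ _ removable_pair[OF v a(1) a(2)[symmetric] deg]]) auto
    next
      case False
      then obtain z where "z \<in> verts T" "z \<notin> {l, v, x}" "z \<notin> nbrs x" by blast
      then show ?thesis by (intro fin[OF _ _ _ removable_empty]) auto
    qed
  next
    case 3
    then obtain l l' where L: "L = {l, l'}" "l \<noteq> l'" by (meson card_2_iff)
    then obtain v x v' x' where l: "pendant l v x" and l': "pendant l' v' x'"
      using LD[of l] LD[of l'] by blast
    have vv': "v \<noteq> v'" using inj[OF l] l' L(2) by blast
    have fin: ?thesis
      if L: "L = {l, l'}" "l \<noteq> l'" and l: "pendant l v x" and l': "pendant l' v' x'"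
        and z: "z \<in> verts T" "z \<notin> {l, v, l', v', x'}" "z \<in> nbrs x' \<Longrightarrow> {v', z} \<in> R" "removable R"
      for l v x l' v' x' z R
    proof (rule construction[where w = "\<lambda>i. if i = l then l' else z" and R = R])
      have sel: "p = l \<and> q = v \<and> r = x \<or> p = l' \<and> q = v' \<and> r = x'" if "pendant p q r" for p q r
        using LI[OF that] L pendant_unique[OF that, of v x] pendant_unique[OF that, of v' x'] l l' by auto
      show "(if p = l then l' else z) \<in> verts T \<and> (if p = l then l' else z) \<notin> {p, q, r} \<and>
          ((if p = l then l' else z) \<in> nbrs r \<longrightarrow> {q, if p = l then l' else z} \<in> R)"
        if "pendant p q r" for p q r
        using sel[OF that] far[OF l l' L(2)] z L(2) by auto
      show "(if p' = l then l' else z) \<notin> {p, q}"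
        if "pendant p q r" "pendant p' q' r'" "p \<noteq> p'" "(if p = l then l' else z) \<in> {p', q'}"
        for p q r p' q' r'
        using sel[OF that(1)] sel[OF that(2)] that(3,4) z(2) L(2) by (auto split: if_splits)
    qed (rule z)
    show ?thesis
    proof (cases "verts T \<subseteq> {l, v, l', v', x} \<union> nbrs x \<and> verts T \<subseteq> {l, v, l', v', x'} \<union> nbrs x'")
      case True
      then have "x = x'" using isomorphic_P6[OF l l' vv' nonadj[OF l l']] P6 by blast
      then have deg: "4 \<le> card (nbrs x')"
        using P5_or_T12_or_large_degree[of l v x' l' v'] l l' vv' True P5 T12 by blast
      have v: "v' \<in> nbrs x'" "v \<in> nbrs x'"
        using pendant_support l l' \<open>x = x'\<close> by blast+
      have "2 \<le> card (nbrs x' - {v, v'})" using deg v vv' finite_nbrs by (simp add: card_Diff_subset)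
      then obtain a where a: "a \<in> nbrs x'" "a \<noteq> v" "v' \<noteq> a" using two_elements by blast
      have "a \<noteq> x'" using a nbrs_irrefl by blast
      moreover have "a \<noteq> l" "a \<noteq> l'"
        using a l l' \<open>x = x'\<close> pendant_distinct[OF l] pendant_distinct[OF l'] nbrs_sym[of a x']
        by (auto simp: pendant_def)
      ultimately show ?thesis
        using a nbrs_verts(1)[OF a(1)]
        by (intro fin[OF L l l' _ _ _ removable_pair[OF v(1) a(1) a(3) deg]]) auto
    next
      case False
      then consider z where "z \<in> verts T" "z \<notin> {l, v, l', v', x}" "z \<notin> nbrs x"
        | z where "z \<in> verts T" "z \<notin> {l, v, l', v', x'}" "z \<notin> nbrs x'" by blast
      then show ?thesis
      proof cases
        case 1
        then show ?thesis
          using L by (intro fin[OF _ _ l' l _ _ _ removable_empty]) auto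
      next
        case 2
        then show ?thesis by (intro fin[OF L l l' _ _ _ removable_empty]) auto
      qed
    qed
  next
    case 4
    then obtain s where s: "\<And>l. l \<in> L \<Longrightarrow> s l \<in> L \<and> s l \<noteq> l \<and> s (s l) \<noteq> l"
      using exists_shift_without_short_cycles[OF \<open>finite L\<close>] by blast
    have not_support: "s p \<noteq> v" if "p \<in> L" "pendant l v x" for p l v x
      using s[OF that(1)] LD[of "s p"] pendant_leaf_not_support[OF _ that(2)] by blast
    show ?thesis
    proof (rule construction[where w = s and R = "{}"])
      show "s l \<in> verts T \<and> s l \<notin> {l, v, x} \<and> (s l \<in> nbrs x \<longrightarrow> {v, s l} \<in> {})"
        if l: "pendant l v x" for l v x
      proof -
        have "s l \<noteq> l" "s l \<in> L" using s[OF LI[OF l]] by simp_all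
        then obtain v' x' where "pendant (s l) v' x'" using LD by blast
        then show ?thesis using far[OF l] \<open>s l \<noteq> l\<close> by metis
      qed
      show "s l' \<notin> {l, v}"
        if l: "pendant l v x" and l': "pendant l' v' x'" and sl: "s l \<in> {l', v'}" for l v x l' v' x'
      proof -
        have "l \<in> L" "l' \<in> L" using l l' LI by simp_all
        then have "s l = l'" using not_support[OF _ l'] sl by blast
        then have "s l' \<noteq> l" using s[OF \<open>l \<in> L\<close>] by simp
        then show ?thesis using not_support[OF \<open>l' \<in> L\<close> l] by simp
      qed
    qed (rule removable_empty)
  qed
qed

end

theorem theorem6:
  fixes T :: "'a hypergraph"
  assumes "tree T"
    and "\<not> isomorphic T (path_graph 2)"
    and "\<not> isomorphic T (path_graph 3)"
    and "\<not> isomorphic T (path_graph 4)"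
    and "\<not> isomorphic T (path_graph 5)"
    and "\<not> isomorphic T (path_graph 6)"
    and "\<not> isomorphic T T7"
    and "\<not> isomorphic T T12"
  shows "\<exists>H :: 'a hypergraph. uniform_hypergraph 3 H \<and> verts H = verts T \<and> EI H = T"
  by (rule tree_graph.edge_intersection_of_3_uniform[OF tree_graph.intro]) (fact assms)+

end
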